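(* Every infinite-dimensional separable real Banach space $X$ admits an equivalent rotund norm such that the set of its midpoint locally uniformly rotund (MLUR) points is porous in the unit sphere of that norm, the unit sphere being equipped with the metric induced by the norm.
   Context: Let $|\cdot|$ be an equivalent norm on $X$, with closed unit ball $B=\{x:|x|\le 1\}$ and unit sphere $S=\{x: |x|=1\}$. - $|\cdot|$ is rotund if every $x\in S$ is an extreme point of $B$, i.e. $y,z\in B$ and $2x=y+z$ imply $x=y=z$. - A point $x\in S$ is an MLUR point if whenever $(x_n),(y_n)\subset X$ satisfy $|x_n|\to |x|$, $|y_n|\to|x|$ and $\left|\frac{x_n+y_n}{2}-x\right|\to 0$, then $|x_n-y_n|\to 0$. - A subset $P$ of a metric space $(T,d)$ is called porous if there are numbers $\lambda\in(0,1)$ and $\delta_0>0$ such that for every $x\in P$ and every $0<\delta<\delta_0$ there exists $y\in T$ with $d(x,y)<\delta$ and $P\cap\{t\in T: d(t,y)<\lambda\delta\}=\emptyset$. *)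

theory Defs
  imports "HOL-Analysis.Analysis"
begin

definition equivalent_norm :: "('a::real_normed_vector \<Rightarrow> real) \<Rightarrow> bool" where
  "equivalent_norm N \<longleftrightarrow>
     (\<forall>x. N x = 0 \<longleftrightarrow> x = 0) \<and>
     (\<forall>x y. N (x + y) \<le> N x + N y) \<and>
     (\<forall>a x. N (a *\<^sub>R x) = \<bar>a\<bar> * N x) \<and>
     (\<exists>c>0. \<exists>C>0. \<forall>x. c * norm x \<le> N x \<and> N x \<le> C * norm x)"

definition unit_ball_of :: "('a::real_vector \<Rightarrow> real) \<Rightarrow> 'a set" where
  "unit_ball_of N = {x. N x \<le> 1}"

definition unit_sphere_of :: "('a::real_vector \<Rightarrow> real) \<Rightarrow> 'a set" where
  "unit_sphere_of N = {x. N x = 1}"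

(* Extreme points of the (convex) unit ball are described through midpoints;
   rotund_iff_extreme_point below relates this to extreme_point_of. *)
definition rotund :: "('a::real_vector \<Rightarrow> real) \<Rightarrow> bool" where
  "rotund N \<longleftrightarrow>
     (\<forall>x \<in> unit_sphere_of N. \<forall>y \<in> unit_ball_of N. \<forall>z \<in> unit_ball_of N.
        2 *\<^sub>R x = y + z \<longrightarrow> x = y \<and> y = z)"

definition MLUR_points :: "('a::real_vector \<Rightarrow> real) \<Rightarrow> 'a set" where
  "MLUR_points N = {x \<in> unit_sphere_of N.
     \<forall>X Y :: nat \<Rightarrow> 'a.
       (\<lambda>n. N (X n)) \<longlonglongrightarrow> N x \<and> (\<lambda>n. N (Y n)) \<longlonglongrightarrow> N x \<and>
       (\<lambda>n. N ((1/2) *\<^sub>R (X n + Y n) - x)) \<longlonglongrightarrow> 0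
       \<longrightarrow> (\<lambda>n. N (X n - Y n)) \<longlonglongrightarrow> 0}"

definition (in Metric_space) porous :: "'a set \<Rightarrow> bool" where
  "porous P \<longleftrightarrow> P \<subseteq> M \<and>
     (\<exists>\<kappa> \<delta>\<^sub>0. 0 < \<kappa> \<and> \<kappa> < 1 \<and> 0 < \<delta>\<^sub>0 \<and>
        (\<forall>x\<in>P. \<forall>\<delta>. 0 < \<delta> \<and> \<delta> < \<delta>\<^sub>0 \<longrightarrow>
           (\<exists>y\<in>M. d x y < \<delta> \<and> P \<inter> mball y (\<kappa> * \<delta>) = {})))"

lemma equivalent_norm_Metric_space:
  assumes "equivalent_norm N"
  shows "Metric_space T (\<lambda>x y. N (x - y))"
proof
  fix x y z
  obtain c where c: "c > 0" "\<And>u. c * norm u \<le> N u"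
    using assms unfolding equivalent_norm_def by blast
  show "0 \<le> N (x - y)"
    by (rule order.trans[OF _ c(2)]) (use c(1) in simp)
  have "N (- 1 *\<^sub>R (y - x)) = \<bar>- 1\<bar> * N (y - x)"
    using assms unfolding equivalent_norm_def by blast
  then show "N (x - y) = N (y - x)" by simp
  have "N (x - y) = 0 \<longleftrightarrow> x - y = 0"
    using assms unfolding equivalent_norm_def by blast
  then show "N (x - y) = 0 \<longleftrightarrow> x = y" by simp
  have "N ((x - y) + (y - z)) \<le> N (x - y) + N (y - z)"
    using assms unfolding equivalent_norm_def by blast
  then show "N (x - z) \<le> N (x - y) + N (y - z)" by simp
qed

lemma convex_unit_ball_of:
  assumes "equivalent_norm N"
  shows "convex (unit_ball_of N)"
proof (rule convexI)
  fix x y and u v :: real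
  assume xy: "x \<in> unit_ball_of N" "y \<in> unit_ball_of N" and uv: "0 \<le> u" "0 \<le> v" "u + v = 1"
  have "N (u *\<^sub>R x + v *\<^sub>R y) \<le> N (u *\<^sub>R x) + N (v *\<^sub>R y)"
    using assms unfolding equivalent_norm_def by blast
  also have "\<dots> = \<bar>u\<bar> * N x + \<bar>v\<bar> * N y"
    using assms unfolding equivalent_norm_def by metis
  also have "\<dots> = u * N x + v * N y"
    using uv by simp
  also have "\<dots> \<le> u * 1 + v * 1"
    using xy uv by (intro add_mono mult_left_mono) (auto simp: unit_ball_of_def)
  finally show "u *\<^sub>R x + v *\<^sub>R y \<in> unit_ball_of N"
    using uv by (simp add: unit_ball_of_def)
qed

lemma rotund_iff_extreme_point:
  assumes "equivalent_norm N"
  shows "rotund N \<longleftrightarrow> (\<forall>x \<in> unit_sphere_of N. x extreme_point_of unit_ball_of N)"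
proof -
  have "x extreme_point_of unit_ball_of N \<longleftrightarrow>
      (\<forall>y \<in> unit_ball_of N. \<forall>z \<in> unit_ball_of N. 2 *\<^sub>R x = y + z \<longrightarrow> x = y \<and> y = z)"
    if x: "x \<in> unit_sphere_of N" for x
  proof -
    have L: "\<forall>y \<in> unit_ball_of N. \<forall>z \<in> unit_ball_of N. 2 *\<^sub>R x = y + z \<longrightarrow> x = y \<and> y = z"
      if "x extreme_point_of unit_ball_of N"
    proof (intro ballI impI)
      fix y z
      assume yz: "y \<in> unit_ball_of N" "z \<in> unit_ball_of N" "2 *\<^sub>R x = y + z"
      then have "(1/2) *\<^sub>R (2 *\<^sub>R x) = (1/2) *\<^sub>R (y + z)" by (simp only:)
      then have m: "x = (1 - 1/2) *\<^sub>R y + (1/2) *\<^sub>R z" by (simp add: scaleR_add_right)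
      have "x \<notin> open_segment y z"
        using that yz by (simp add: extreme_point_of_def)
      have "y = z"
      proof (rule ccontr)
        assume "y \<noteq> z"
        moreover have "(0::real) < 1/2" "(1/2::real) < 1" by simp_all
        ultimately have "x \<in> open_segment y z"
          unfolding in_segment using m by (intro conjI exI[of _ "1/2"])
        with \<open>x \<notin> open_segment y z\<close> show False ..
      qed
      then show "x = y \<and> y = z"
        using m scaleR_add_left[of "1 - 1/2" "1/2" z] by simp
    qed
    have R: "x extreme_point_of unit_ball_of N"
      if H: "\<forall>y \<in> unit_ball_of N. \<forall>z \<in> unit_ball_of N. 2 *\<^sub>R x = y + z \<longrightarrow> x = y \<and> y = z"
    proof -
      have "x \<notin> open_segment a b"
        if ab: "a \<in> unit_ball_of N" "b \<in> unit_ball_of N" for a b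
      proof
        assume "x \<in> open_segment a b"
        then obtain u where u: "a \<noteq> b" "0 < u" "u < 1" "x = (1 - u) *\<^sub>R a + u *\<^sub>R b"
          unfolding in_segment by blast
        define r where "r = min u (1 - u)"
        have r: "0 < r" "r \<le> u" "r \<le> 1 - u" using u by (auto simp: r_def)
        define w where "w = b - a"
        have mem: "a + t *\<^sub>R w \<in> unit_ball_of N" if "0 \<le> t" "t \<le> 1" for t
        proof -
          have "(1 - t) *\<^sub>R a + t *\<^sub>R b \<in> unit_ball_of N"
            using convexD[OF convex_unit_ball_of[OF assms] ab] that by simp
          also have "(1 - t) *\<^sub>R a + t *\<^sub>R b = a + t *\<^sub>R w"
            by (simp add: w_def scaleR_diff_left scaleR_diff_right)
          finally show ?thesis .
        qed
        have "x = a + u *\<^sub>R w"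
          by (simp add: u(4) w_def scaleR_diff_left scaleR_diff_right)
        then have sum: "2 *\<^sub>R x = (a + (u - r) *\<^sub>R w) + (a + (u + r) *\<^sub>R w)"
          by (simp add: scaleR_2 scaleR_diff_left scaleR_add_left)
        have "a + (u - r) *\<^sub>R w \<in> unit_ball_of N" "a + (u + r) *\<^sub>R w \<in> unit_ball_of N"
          using mem r u(2,3) by simp_all
        from H[rule_format, OF this sum]
        have "a + (u - r) *\<^sub>R w = a + (u + r) *\<^sub>R w" by (rule conjunct2)
        then have "w = 0"
          using r(1) by (simp add: scaleR_cancel_right)
        then show False using u(1) by (simp add: w_def)
      qed
      then show "x extreme_point_of unit_ball_of N"
        using x by (auto simp: extreme_point_of_def unit_ball_of_def unit_sphere_of_def)
    qed
    from L R show ?thesis by (rule iffI)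
  qed
  from ball_cong[OF refl this] show ?thesis
    unfolding rotund_def by (rule sym)
qed

end

theory Submission
  imports Defs
begin

text \<open>
  Let \<open>h\<^sub>a\<close> be functionals with \<open>\<bar>h\<^sub>a x\<bar> \<le> \<parallel>x\<parallel>\<close> and \<open>h\<^sub>a x \<rightarrow> 0\<close> for every \<open>x\<close>, and \<open>p\<^sub>a\<close> points such
  that every ball of radius \<open>\<delta> < 1\<close> contains some \<open>p\<^sub>a\<close> with \<open>h\<^sub>a p\<^sub>a \<ge> \<delta>/6\<close>: take \<open>h\<^sub>a\<close> annihilating the
  first terms \<open>z\<^sub>0, \<dots>, z\<^sub>a\<close> of a dense sequence, \<open>u\<^sub>a\<close> in the unit ball with \<open>h\<^sub>a u\<^sub>a \<ge> 1/2\<close>, and let the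
  \<open>p\<^sub>a\<close> run through the points \<open>z\<^sub>i + u\<^sub>a/(j+1)\<close> with \<open>i \<le> a\<close>.  With \<open>g\<^sub>a\<close> norming \<open>p\<^sub>a\<close>, put
  \<open>M x = sup\<^sub>a (\<bar>g\<^sub>a x\<bar> + \<bar>h\<^sub>a x\<bar>)\<close> and \<open>N x = sqrt (M(x)\<^sup>2 + \<Sum>\<^sub>i 4\<^sup>-\<^sup>i g\<^sub>i(x)\<^sup>2)\<close>; the series makes \<open>N\<close>
  rotund.  If \<open>M x > \<parallel>x\<parallel>\<close>, only finitely many terms of the supremum are close to \<open>M x\<close>, so there are
  vectors \<open>y\<^sub>n\<close> of fixed norm with \<open>M(x \<plusminus> y\<^sub>n) = M x\<close> and \<open>g\<^sub>i y\<^sub>n = 0\<close> for \<open>i < n\<close>; then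
  \<open>N(x \<plusminus> y\<^sub>n) \<rightarrow> N x\<close>, and \<open>x\<close> is not an MLUR point.  Finally \<open>M p\<^sub>a - \<parallel>p\<^sub>a\<parallel> \<ge> h\<^sub>a p\<^sub>a\<close> is of order \<open>\<delta>\<close> for
  some \<open>p\<^sub>a\<close> within \<open>\<delta>\<close> of any given point, and \<open>M - \<parallel>\<cdot>\<parallel>\<close> is Lipschitz, so the set \<open>M = \<parallel>\<cdot>\<parallel>\<close> is porous.
\<close>

section \<open>Sublinear functionals and the Hahn--Banach theorem\<close>

definition sublinear :: "('a::real_vector \<Rightarrow> real) \<Rightarrow> bool" where
  "sublinear q \<longleftrightarrow> (\<forall>x y. q (x + y) \<le> q x + q y) \<and> (\<forall>t\<ge>0. \<forall>x. q (t *\<^sub>R x) \<le> t * q x)"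

lemma sublinear_add: "sublinear q \<Longrightarrow> q (x + y) \<le> q x + q y"
  and sublinear_scale: "sublinear q \<Longrightarrow> 0 \<le> t \<Longrightarrow> q (t *\<^sub>R x) \<le> t * q x"
  by (auto simp: sublinear_def)

lemma sublinear_zero: "sublinear q \<Longrightarrow> q 0 = 0"
  using sublinear_add[of q 0 0] sublinear_scale[of q 0 0] by simp

lemma sublinear_ge_uminus: "sublinear q \<Longrightarrow> - q (- x) \<le> q x"
  using sublinear_add[of q x "- x"] sublinear_zero[of q] by simp

text \<open>Applying the inequality with the factor \<open>1 / t\<close> gives the converse. Hence
  only the inequality has to be checked for the infima formed below.\<close>

lemma sublinear_scale_eq:
  assumes "sublinear q" "0 \<le> t"
  shows "q (t *\<^sub>R x) = t * q x"
proof (cases "t = 0")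
  case True
  then show ?thesis using sublinear_zero[OF assms(1)] by simp
next
  case False
  then have "q ((1 / t) *\<^sub>R (t *\<^sub>R x)) \<le> (1 / t) * q (t *\<^sub>R x)"
    using assms by (intro sublinear_scale) auto
  then have "t * q x \<le> q (t *\<^sub>R x)"
    using False assms(2) by (simp add: field_simps)
  then show ?thesis using sublinear_scale[OF assms, of x] by linarith
qed

text \<open>The largest sublinear functional below \<open>q\<close> whose value at \<open>- v\<close> is at most \<open>- q v\<close>.\<close>

lemma sublinear_tilt:
  assumes q: "sublinear q"
  obtains r where "sublinear r" "\<And>x. r x \<le> q x" "r (- v) \<le> - q v"
proof -
  \<comment> \<open>A sublinear \<open>s\<close> below \<open>q\<close> with
    \<open>s (- v) \<le> - q v\<close> satisfies
    \<open>s x \<le> s (x + t *\<^sub>R v) + t * s (- v) \<le> F x t\<close> for all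
    \<open>t \<ge> 0\<close>, so the infimum over \<open>t\<close> is the only candidate for the
    largest one.\<close>
  define F where "F = (\<lambda>x t. q (x + t *\<^sub>R v) - t * q v)"
  define r where "r = (\<lambda>x. INF t\<in>{0..}. F x t)"
  have lower: "- q (- x) \<le> F x t" if "0 \<le> t" for x t
    using sublinear_add[OF q, of "x + t *\<^sub>R v" "- x"] sublinear_scale_eq[OF q that, of v]
    by (simp add: F_def)
  have r_le: "r x \<le> F x t" if "0 \<le> t" for x t
    unfolding r_def using lower that by (intro cINF_lower bdd_belowI2[where m = "- q (- x)"]) auto
  have r_ge: "m \<le> r x" if "\<And>t. 0 \<le> t \<Longrightarrow> m \<le> F x t" for m x
    unfolding r_def using that by (intro cINF_greatest) auto
  have add: "r (x + y) \<le> r x + r y" for x y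
  proof -
    have "r (x + y) - F x s \<le> F y t" if "0 \<le> s" "0 \<le> t" for s t
    proof -
      have "r (x + y) \<le> F (x + y) (s + t)" using that by (intro r_le) simp
      also have "\<dots> \<le> F x s + F y t"
        using sublinear_add[OF q, of "x + s *\<^sub>R v" "y + t *\<^sub>R v"]
        by (simp add: F_def algebra_simps)
      finally show ?thesis by simp
    qed
    then have "r (x + y) - F x s \<le> r y" if "0 \<le> s" for s
      using that by (intro r_ge)
    then have "r (x + y) - r y \<le> F x s" if "0 \<le> s" for s
      using that by (simp add: algebra_simps)
    then have "r (x + y) - r y \<le> r x"
      by (intro r_ge)
    then show ?thesis by simp
  qed
  have scale: "r (t *\<^sub>R x) \<le> t * r x" if "0 \<le> t" for t x
  proof (cases "t = 0")
    case True
    have "r 0 \<le> F 0 0" by (rule r_le) simp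
    then show ?thesis using True by (simp add: F_def sublinear_zero[OF q])
  next
    case False
    with that have t: "t > 0" by simp
    have "r (t *\<^sub>R x) / t \<le> F x s" if s: "0 \<le> s" for s
    proof -
      have "r (t *\<^sub>R x) \<le> F (t *\<^sub>R x) (t * s)" using s t by (intro r_le) simp
      also have "\<dots> = t * F x s"
        using sublinear_scale_eq[OF q, of t "x + s *\<^sub>R v"] t
        by (simp add: F_def algebra_simps)
      finally show ?thesis using t by (simp add: field_simps)
    qed
    then have "r (t *\<^sub>R x) / t \<le> r x" by (rule r_ge)
    then show ?thesis using t by (simp add: field_simps)
  qed
  show thesis
  proof
    show "sublinear r" using add scale by (simp add: sublinear_def)
    show "r x \<le> q x" for x using r_le[of 0 x] by (simp add: F_def)
    show "r (- v) \<le> - q v" using r_le[of 1 "- v"] by (simp add: F_def sublinear_zero[OF q])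
  qed
qed

text \<open>Hahn--Banach: by \<open>sublinear_tilt\<close>, a minimal sublinear functional is additive.\<close>

lemma ex_linear_le_sublinear:
  assumes p: "sublinear p"
  obtains f where "linear f" "\<And>x. f x \<le> p x"
proof -
  define A where "A = {q. sublinear q \<and> (\<forall>x. q x \<le> p x)}"
  \<comment> \<open>The order is reversed, so the maximal element given by Zorn's lemma is a minimal
    sublinear functional below \<open>p\<close>.\<close>
  define P where "P = (\<lambda>q r :: 'a \<Rightarrow> real. \<forall>x. r x \<le> q x)"
  have "partial_order_on A (relation_of P A)"
    by (rule partial_order_on_relation_ofI) (auto simp: P_def fun_eq_iff intro: order.trans antisym)
  moreover have "\<exists>u\<in>A. \<forall>a\<in>C. P a u" if C: "C \<in> Chains (relation_of P A)" for C
  proof (cases "C = {}")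
    case True
    then show ?thesis using p by (auto simp: A_def)
  next
    case False
    have CA: "C \<subseteq> A" and chain: "\<And>q r. q \<in> C \<Longrightarrow> r \<in> C \<Longrightarrow> P q r \<or> P r q"
      using C by (auto simp: Chains_def relation_of_def)
    have sub: "sublinear q" "q x \<le> p x" if "q \<in> C" for q x
      using that CA by (auto simp: A_def)
    define u where "u = (\<lambda>x. INF q\<in>C. q x)"
    have lower: "- p (- x) \<le> q x" if "q \<in> C" for q x
      using sublinear_ge_uminus[OF sub(1)[OF that], of x] sub(2)[OF that, of "- x"] by simp
    have u_le: "u x \<le> q x" if "q \<in> C" for q x
      unfolding u_def using that lower by (intro cINF_lower bdd_belowI2[where m = "- p (- x)"]) auto
    have u_ge: "m \<le> u x" if "\<And>q. q \<in> C \<Longrightarrow> m \<le> q x" for m x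
      unfolding u_def using that False by (intro cINF_greatest) auto
    have add: "u (x + y) \<le> u x + u y" for x y
    proof -
      have *: "u (x + y) \<le> q x + r y" if qr: "q \<in> C" "r \<in> C" for q r
      proof -
        \<comment> \<open>Since \<open>C\<close> is a chain, the smaller of \<open>q\<close> and
          \<open>r\<close> lies below both; this is what carries subadditivity over to the
          infimum.\<close>
        obtain m where m: "m \<in> C" "m x \<le> q x" "m y \<le> r y"
          using chain[OF qr] qr by (auto simp: P_def)
        have "u (x + y) \<le> m (x + y)" using m by (intro u_le)
        also have "\<dots> \<le> m x + m y" using m sub by (intro sublinear_add)
        finally show ?thesis using m by simp
      qed
      have "u (x + y) - q x \<le> u y" if "q \<in> C" for q
      proof (rule u_ge)
        fix r assume "r \<in> C"
        then show "u (x + y) - q x \<le> r y" using *[OF that, of r] by simp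
      qed
      then have "u (x + y) - u y \<le> u x"
        by (intro u_ge) (simp add: algebra_simps)
      then show ?thesis by simp
    qed
    have scale: "u (t *\<^sub>R x) \<le> t * u x" if "0 \<le> t" for t x
    proof (cases "t = 0")
      case True
      obtain q where "q \<in> C" using False by auto
      then show ?thesis using u_le[of q 0] sublinear_zero[OF sub(1), of q] True by simp
    next
      case False
      with that have t: "t > 0" by simp
      have "u (t *\<^sub>R x) / t \<le> q x" if "q \<in> C" for q
        using u_le[OF that, of "t *\<^sub>R x"] sublinear_scale_eq[OF sub(1)[OF that], of t x] t
        by (simp add: field_simps)
      then have "u (t *\<^sub>R x) / t \<le> u x" by (rule u_ge)
      then show ?thesis using t by (simp add: field_simps)
    qed
    obtain q where "q \<in> C" using False by auto
    then have "u x \<le> p x" for x using u_le[of q x] sub(2)[of q x] by simp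
    then have "u \<in> A" using add scale by (simp add: A_def sublinear_def)
    then show ?thesis using u_le by (auto simp: P_def)
  qed
  ultimately obtain f where f: "f \<in> A" and min: "\<And>q. q \<in> A \<Longrightarrow> P f q \<Longrightarrow> q = f"
    using predicate_Zorn[of A P] by blast
  have sf: "sublinear f" and fp: "\<And>x. f x \<le> p x" using f by (auto simp: A_def)
  have uminus: "f (- v) = - f v" for v
  proof -
    obtain r where r: "sublinear r" "\<And>x. r x \<le> f x" "r (- v) \<le> - f v"
      using sublinear_tilt[OF sf] by blast
    have "r \<in> A" using r fp by (auto simp: A_def intro: order.trans)
    then have "r = f" using r by (intro min) (auto simp: P_def)
    then show ?thesis using r(3) sublinear_ge_uminus[OF sf, of "v"] by simp
  qed
  have "linear f"
  proof (rule linearI)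
    fix x y
    have "- f (x + y) \<le> - f x - f y"
      using sublinear_add[OF sf, of "- x" "- y"] uminus[of x] uminus[of y] uminus[of "x + y"] by simp
    then show "f (x + y) = f x + f y" using sublinear_add[OF sf, of x y] by simp
    show "f (c *\<^sub>R x) = c *\<^sub>R f x" for c
      using sublinear_scale_eq[OF sf, of c x] sublinear_scale_eq[OF sf, of "- c" x]
        uminus[of "c *\<^sub>R x"] by (cases "0 \<le> c") auto
  qed
  then show thesis using fp that by blast
qed

section \<open>Norming functionals, annihilators and common kernels\<close>

lemma abs_linear_le:
  fixes f :: "'a::real_normed_vector \<Rightarrow> real"
  assumes "linear f" "\<And>x. f x \<le> norm x"
  shows "\<bar>f x\<bar> \<le> norm x"
  using assms(2)[of x] assms(2)[of "- x"] linear_neg[OF assms(1), of x] by simp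

text \<open>A linear minorant of the norm alone may be small at \<open>v\<close>. Tilting the norm
  along \<open>v\<close> first forces \<open>f (- v) \<le> - norm v\<close>.\<close>

lemma ex_norming_functional:
  fixes v :: "'a::real_normed_vector"
  obtains f where "linear f" "\<And>x. \<bar>f x\<bar> \<le> norm x" "f v = norm v"
proof -
  have "sublinear (norm :: 'a \<Rightarrow> real)"
    by (auto simp: sublinear_def norm_triangle_ineq)
  then obtain r where r: "sublinear r" "\<And>x. r x \<le> norm x" "r (- v) \<le> - norm v"
    using sublinear_tilt by blast
  then obtain f where f: "linear f" "\<And>x. f x \<le> r x"
    using ex_linear_le_sublinear by blast
  have f_le: "f x \<le> norm x" for x using f(2)[of x] r(2)[of x] by simp
  have "f v = norm v"
    using f(2)[of "- v"] r(3) f_le[of v] linear_neg[OF f(1), of v] by simp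
  then show thesis using that f(1) abs_linear_le[OF f(1) f_le] by blast
qed

text \<open>Induction on \<open>A\<close>. If \<open>k\<close> vanishes on \<open>A\<close> and
  \<open>k b = 1\<close>, a functional \<open>f\<close> found for the projected vector
  \<open>v - k v *\<^sub>R b\<close> is corrected to \<open>f - f b * k\<close>, which vanishes at
  \<open>b\<close> as well.\<close>

lemma ex_functional_vanishing:
  fixes v :: "'a::real_normed_vector"
  assumes "finite A" "v \<notin> span A"
  shows "\<exists>f :: 'a \<Rightarrow> real. bounded_linear f \<and> (\<forall>a\<in>A. f a = 0) \<and> f v = 1"
  using assms
proof (induction A arbitrary: v rule: finite_induct)
  case empty
  then have "v \<noteq> 0" by simp
  obtain f where f: "linear f" "\<And>x. \<bar>f x\<bar> \<le> norm x" "f v = norm v"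
    using ex_norming_functional by blast
  have "bounded_linear f"
    using f(1,2) by (auto intro: bounded_linear_intro[where K = 1] simp: linear_add linear_scale)
  then have "bounded_linear (\<lambda>x. f x / norm v)"
    by (rule bounded_linear_divide[THEN bounded_linear_compose])
  then show ?case using f(3) \<open>v \<noteq> 0\<close> by (intro exI[of _ "\<lambda>x. f x / norm v"]) auto
next
  case (insert b A)
  show ?case
  proof (cases "b \<in> span A")
    case True
    then have "v \<notin> span A" using insert.prems by (simp add: span_redundant)
    then obtain f where f: "bounded_linear f" "\<forall>a\<in>A. f a = 0" "f v = (1::real)"
      using insert.IH by blast
    have "f b = 0"
      using True f(1,2) linear_eq_0_on_span[OF bounded_linear.linear[OF f(1)]] by blast
    then show ?thesis using f by blast
  next
    case False
    then obtain k where k: "bounded_linear k" "\<forall>a\<in>A. k a = 0" "k b = (1::real)"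
      using insert.IH by blast
    have "v - k v *\<^sub>R b \<notin> span A"
      using insert.prems by (auto simp: span_insert)
    then obtain f where f: "bounded_linear f" "\<forall>a\<in>A. f a = 0" "f (v - k v *\<^sub>R b) = (1::real)"
      using insert.IH by blast
    interpret k: bounded_linear k by fact
    interpret f: bounded_linear f by fact
    have "bounded_linear (\<lambda>x. f x - f b * k x)"
      by (intro bounded_linear_sub f(1) bounded_linear_const_mult k(1))
    moreover have "f v - f b * k v = 1"
      using f(3) by (simp add: f.diff f.scaleR mult.commute)
    ultimately show ?thesis using f(2) k(2,3)
      by (intro exI[of _ "\<lambda>x. f x - f b * k x"]) auto
  qed
qed

text \<open>The induction shows that the common kernel has finite codimension: together with a
  finite set \<open>B\<close> it spans the space. A vector outside \<open>span B\<close> then has a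
  nonzero kernel component.\<close>

lemma ex_common_kernel:
  fixes F :: "('a::real_vector \<Rightarrow> real) set"
  assumes "finite F" "\<And>f. f \<in> F \<Longrightarrow> linear f"
    and inf: "\<not> (\<exists>B :: 'a set. finite B \<and> span B = UNIV)"
  obtains y where "y \<noteq> 0" "\<And>f. f \<in> F \<Longrightarrow> f y = 0"
proof -
  have "\<exists>B. finite B \<and> (\<forall>x. \<exists>k. x - k \<in> span B \<and> (\<forall>f\<in>F. f k = 0))"
    using assms(1,2)
  proof (induction F rule: finite_induct)
    case empty
    show ?case by (intro exI[of _ "{}"] conjI allI exI) auto
  next
    case (insert f F)
    then obtain B where B: "finite B" "\<And>x. \<exists>k. x - k \<in> span B \<and> (\<forall>f\<in>F. f k = 0)"
      by auto
    show ?case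
    proof (cases "\<exists>w. (\<forall>f\<in>F. f w = 0) \<and> f w \<noteq> 0")
      case False
      then show ?thesis using B by (metis insert_iff)
    next
      case True
      then obtain w where w: "\<And>e. e \<in> F \<Longrightarrow> e w = 0" "f w \<noteq> 0" by auto
      have "\<exists>k. x - k \<in> span (insert w B) \<and> (\<forall>e\<in>insert f F. e k = 0)" for x
      proof -
        obtain k where k: "x - k \<in> span B" "\<forall>f\<in>F. f k = 0" using B(2) by blast
        \<comment> \<open>Since \<open>w\<close> is in the common kernel of \<open>F\<close> but
          \<open>f w \<noteq> 0\<close>, moving along \<open>w\<close> removes the value of
          \<open>f\<close> and keeps the others.\<close>
        define l where "l = k - (f k / f w) *\<^sub>R w"
        have el: "e l = e k - (f k / f w) * e w" if "e \<in> insert f F" for e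
          using insert.prems[OF that] by (simp add: l_def linear_diff linear_scale)
        have "e l = 0" if "e \<in> insert f F" for e
          using el[OF that] that k(2) w by auto
        then have "\<forall>e\<in>insert f F. e l = 0" by blast
        moreover have "(x - k) + (f k / f w) *\<^sub>R w \<in> span (insert w B)"
          using k(1) span_mono[of B "insert w B"]
          by (intro span_add span_scale) (auto intro: span_base)
        ultimately show ?thesis by (intro exI[of _ l]) (simp add: l_def algebra_simps)
      qed
      then show ?thesis using B(1) by (intro exI[of _ "insert w B"]) auto
    qed
  qed
  then obtain B where B: "finite B" "\<And>x. \<exists>k. x - k \<in> span B \<and> (\<forall>f\<in>F. f k = 0)" by auto
  with inf obtain x where "x \<notin> span B" by blast
  moreover obtain k where "x - k \<in> span B" "\<forall>f\<in>F. f k = 0" using B(2) by blast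
  ultimately show thesis by (intro that[of k]) auto
qed

text \<open>A nonzero bounded functional vanishing on \<open>A\<close> is divided by its operator
  norm; any value below 1, here \<open>1 / 2\<close>, is then reached on the unit ball.\<close>

lemma ex_normalized_annihilator:
  assumes "finite A" and inf: "\<not> (\<exists>B :: 'a::real_normed_vector set. finite B \<and> span B = UNIV)"
  shows "\<exists>(h :: 'a \<Rightarrow> real) u. linear h \<and> (\<forall>x. \<bar>h x\<bar> \<le> norm x) \<and> (\<forall>a\<in>A. h a = 0) \<and>
           norm u \<le> 1 \<and> 1 / 2 \<le> h u"
proof -
  obtain v where "v \<notin> span A" using assms by blast
  then obtain f where f: "bounded_linear f" "\<forall>a\<in>A. f a = 0" "f v = (1::real)"
    using ex_functional_vanishing[OF assms(1)] by blast
  interpret f: bounded_linear f by fact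
  define K where "K = onorm f"
  have le: "\<bar>f x\<bar> \<le> K * norm x" for x
    unfolding K_def using onorm[OF f(1), of x] by simp
  have K: "K > 0"
  proof (rule ccontr)
    assume "\<not> K > 0"
    then have "K * norm v \<le> 0" by (simp add: mult_nonpos_nonneg)
    then show False using le[of v] f(3) by simp
  qed
  have "\<exists>w. K / 2 < \<bar>f w\<bar> / norm w"
  proof (rule ccontr)
    assume "\<not> ?thesis"
    then have "onorm f \<le> K / 2"
      unfolding onorm_def by (intro cSUP_least) (auto simp: not_less)
    then show False using K by (simp add: K_def)
  qed
  then obtain w where w: "K / 2 < \<bar>f w\<bar> / norm w" by blast
  \<comment> \<open>For \<open>w = 0\<close> the quotient is \<open>0\<close> by the convention on
    division, which is not above \<open>K / 2\<close>.\<close>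
  then have w0: "norm w > 0" using K by (cases "w = 0") auto
  define u where "u = (sgn (f w) / norm w) *\<^sub>R w"
  have "f u = \<bar>f w\<bar> / norm w"
    by (simp add: u_def f.scaleR abs_sgn)
  with w have "K / 2 \<le> f u" by simp
  then have "1 / 2 \<le> f u / K" using K by (simp add: pos_le_divide_eq)
  moreover have "norm u \<le> 1" using w0 by (simp add: u_def sgn_if)
  moreover have "linear (\<lambda>x. f x / K)"
    by (rule linearI) (simp_all add: f.add f.scaleR add_divide_distrib)
  ultimately show ?thesis
    using le K f(2)
    by (intro exI[of _ "\<lambda>x. f x / K"] exI[of _ u]) (auto simp: field_simps)
qed

section \<open>The functionals \<open>h a\<close> and the dense points \<open>p a\<close>\<close>

lemma ex_functional_system:
  assumes separable: "separable_space (euclidean :: 'a::real_normed_vector topology)"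
    and inf: "\<not> (\<exists>B :: 'a::real_normed_vector set. finite B \<and> span B = UNIV)"
  obtains p :: "nat \<Rightarrow> 'a::real_normed_vector" and h :: "nat \<Rightarrow> 'a::real_normed_vector \<Rightarrow> real" where
    "\<And>a. linear (h a)" "\<And>a x. \<bar>h a x\<bar> \<le> norm x" "\<And>x. (\<lambda>a. h a x) \<longlonglongrightarrow> 0"
    "\<And>x \<delta>. 0 < \<delta> \<Longrightarrow> \<delta> < 1 \<Longrightarrow> \<exists>a. norm (p a - x) < \<delta> \<and> \<delta> / 6 \<le> h a (p a)"
proof -
  obtain C :: "'a set" where C: "countable C" "closure C = UNIV"
    using separable unfolding separable_space_def euclidean_closure_of topspace_euclidean by blast
  have "C \<noteq> {}"
  proof
    assume "C = {}"
    with C(2) show False by simp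
  qed
  define z where "z = from_nat_into C"
  have dense: "\<exists>i. norm (z i - x) < e" if "e > 0" for x e
  proof -
    have "\<exists>c\<in>C. dist c x < e"
      using closure_approachable[of x C] C(2) that by auto
    then obtain c where "c \<in> C" "dist c x < e" by blast
    moreover obtain i where "from_nat_into C i = c"
      using from_nat_into_surj[OF C(1) \<open>c \<in> C\<close>] by blast
    ultimately show ?thesis by (intro exI[of _ i]) (simp add: z_def dist_norm)
  qed
  have "\<forall>a. \<exists>(h :: 'a \<Rightarrow> real) u. linear h \<and> (\<forall>x. \<bar>h x\<bar> \<le> norm x) \<and>
           (\<forall>y\<in>z ` {..a}. h y = 0) \<and> norm u \<le> 1 \<and> 1 / 2 \<le> h u"
    by (intro allI ex_normalized_annihilator[OF _ inf]) simp
  then have "\<exists>(h :: nat \<Rightarrow> 'a \<Rightarrow> real) u. \<forall>a. linear (h a) \<and> (\<forall>x. \<bar>h a x\<bar> \<le> norm x) \<and>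
           (\<forall>y\<in>z ` {..a}. h a y = 0) \<and> norm (u a) \<le> 1 \<and> 1 / 2 \<le> h a (u a)"
    by (simp only: choice_iff)
  then obtain h :: "nat \<Rightarrow> 'a \<Rightarrow> real" and u where hu: "\<forall>a. linear (h a) \<and> (\<forall>x. \<bar>h a x\<bar> \<le> norm x) \<and>
           (\<forall>y\<in>z ` {..a}. h a y = 0) \<and> norm (u a) \<le> 1 \<and> 1 / 2 \<le> h a (u a)"
    by blast
  have h: "linear (h a)" "\<bar>h a x\<bar> \<le> norm x" "i \<le> a \<Longrightarrow> h a (z i) = 0"
    and u: "norm (u a) \<le> 1" "1 / 2 \<le> h a (u a)" for a x i
    using hu by simp_all
  \<comment> \<open>At each \<open>z i\<close> the sequence is eventually zero; the uniform bound on
    the \<open>h a\<close> extends the limit from the dense set to all \<open>x\<close>.\<close>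
  have lim: "(\<lambda>a. h a x) \<longlonglongrightarrow> 0" for x
  proof (rule LIMSEQ_I)
    fix e :: real assume "e > 0"
    then obtain i where i: "norm (z i - x) < e" using dense by blast
    have "norm (h a x - 0) < e" if "a \<ge> i" for a
    proof -
      have "h a x = - h a (z i - x)" using h(3)[OF that] linear_diff[OF h(1), of a] by simp
      then show ?thesis using h(2)[of a "z i - x"] i by simp
    qed
    then show "\<exists>i. \<forall>a\<ge>i. norm (h a x - 0) < e" by blast
  qed
  \<comment> \<open>The index \<open>a\<close> encodes the pair \<open>(i, j)\<close> and also
    selects \<open>u a\<close> and \<open>h a\<close>. Since
    \<open>prod_encode (i, j) \<ge> i\<close>, the functional \<open>h a\<close> vanishes at
    \<open>z i\<close>.\<close>
  define p where
    "p = (\<lambda>a. z (fst (prod_decode a)) + (1 / (real (snd (prod_decode a)) + 1)) *\<^sub>R u a)"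
  have approx: "\<exists>a. norm (p a - x) < \<delta> \<and> \<delta> / 6 \<le> h a (p a)" if \<delta>: "0 < \<delta>" "\<delta> < 1" for x \<delta>
  proof -
    \<comment> \<open>This \<open>j\<close> gives
      \<open>\<delta> / 3 \<le> s < \<delta> / 2\<close>, the lower bound because
      \<open>\<delta> < 1\<close>. Half of the radius remains for approximating \<open>x\<close> by
      \<open>z i\<close>, and \<open>h a (u a) \<ge> 1 / 2\<close> turns \<open>\<delta> / 3\<close>
      into \<open>\<delta> / 6\<close>.\<close>
    define j where "j = nat \<lfloor>2 / \<delta>\<rfloor>"
    define s where "s = 1 / (real j + 1)"
    have "real j \<le> 2 / \<delta>" "2 / \<delta> < real j + 1"
      using \<delta> by (auto simp: j_def)
    then have "real j * \<delta> \<le> 2" "2 < (real j + 1) * \<delta>"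
      using \<delta> by (auto simp: field_simps)
    then have s: "s > 0" "s < \<delta> / 2" "\<delta> / 3 \<le> s"
      using \<delta> by (auto simp: s_def field_simps)
    obtain i where i: "norm (z i - x) < \<delta> / 2" using dense[of "\<delta> / 2"] \<delta> by auto
    define a where "a = prod_encode (i, j)"
    have pa: "p a = z i + s *\<^sub>R u a" by (simp add: p_def a_def s_def)
    have "i \<le> a" by (simp add: a_def le_prod_encode_1)
    then have "h a (p a) = s * h a (u a)"
      using h(3) by (simp add: pa linear_add[OF h(1)] linear_scale[OF h(1)])
    moreover have "s * (1 / 2) \<le> s * h a (u a)" using s by (intro mult_left_mono u) simp
    moreover have "norm (p a - x) \<le> norm (z i - x) + s * norm (u a)"
      using norm_triangle_ineq[of "z i - x" "s *\<^sub>R u a"] s by (simp add: pa algebra_simps)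
    moreover have "s * norm (u a) \<le> s * 1" using s by (intro mult_left_mono u) simp
    ultimately have "norm (p a - x) < \<delta>" "\<delta> / 6 \<le> h a (p a)" using s i by linarith+
    then show ?thesis by blast
  qed
  show thesis by (rule that[OF h(1,2) lim approx])
qed

section \<open>The norm \<open>N\<close>: equivalence and rotundity\<close>

locale functional_system =
  fixes p :: "nat \<Rightarrow> 'a::real_normed_vector" and g h :: "nat \<Rightarrow> 'a \<Rightarrow> real"
  assumes linear_g: "linear (g a)" and g_le: "\<bar>g a x\<bar> \<le> norm x"
    and g_norming: "g a (p a) = norm (p a)"
    and linear_h: "linear (h a)" and h_le: "\<bar>h a x\<bar> \<le> norm x"
    and h_tendsto: "(\<lambda>a. h a x) \<longlonglongrightarrow> 0"
    and approx: "0 < \<delta> \<Longrightarrow> \<delta> < 1 \<Longrightarrow> \<exists>a. norm (p a - x) < \<delta> \<and> \<delta> / 6 \<le> h a (p a)"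
    and infinite_dim: "\<not> (\<exists>B :: 'a set. finite B \<and> span B = UNIV)"
begin

lemmas g_linear = linear_add[OF linear_g] linear_diff[OF linear_g] linear_scale[OF linear_g]
lemmas h_linear = linear_add[OF linear_h] linear_diff[OF linear_h] linear_scale[OF linear_h]

definition M :: "'a \<Rightarrow> real" where
  "M x = (SUP a. \<bar>g a x\<bar> + \<bar>h a x\<bar>)"

text \<open>The squared norm of the image of \<open>x\<close> under the operator into
  \<open>l2\<close> with coordinates \<open>(1/2) ^ i * g i x\<close>. Adding the square of an
  injective operator into a Hilbert space is the classical way to make a norm rotund.\<close>

definition Q :: "'a \<Rightarrow> real" where
  "Q x = (\<Sum>i. (1/4) ^ i * (g i x)\<^sup>2)"

definition N :: "'a \<Rightarrow> real" where
  "N x = sqrt ((M x)\<^sup>2 + Q x)"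

lemma M_upper: "\<bar>g a x\<bar> + \<bar>h a x\<bar> \<le> M x"
  unfolding M_def
  by (intro cSUP_upper bdd_aboveI2[where M = "norm x + norm x"] add_mono g_le h_le) auto

lemma M_least: "(\<And>a. \<bar>g a x\<bar> + \<bar>h a x\<bar> \<le> m) \<Longrightarrow> M x \<le> m"
  unfolding M_def by (intro cSUP_least) auto

text \<open>The points \<open>p a\<close> are dense and \<open>g a\<close> norms \<open>p a\<close>,
  so the \<open>g a\<close> together determine the norm of every vector.\<close>

lemma norm_le_of_g:
  assumes "\<And>a. \<bar>g a x\<bar> \<le> m"
  shows "norm x \<le> m"
proof (rule field_le_epsilon)
  fix e :: real assume e: "e > 0"
  have "0 < min (e / 2) (1 / 2)" "min (e / 2) (1 / 2) < 1" using e by auto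
  from approx[OF this, of x] obtain a where a: "norm (p a - x) < min (e / 2) (1 / 2)" by blast
  have "norm (p a) = g a x + g a (p a - x)"
    by (simp add: g_linear g_norming)
  moreover have "norm x \<le> norm (p a) + norm (p a - x)"
    by (metis norm_minus_commute norm_triangle_sub)
  ultimately show "norm x \<le> m + e"
    using assms[of a] g_le[of a "p a - x"] a by linarith
qed

lemma norm_le_M: "norm x \<le> M x"
proof (rule norm_le_of_g)
  show "\<bar>g a x\<bar> \<le> M x" for a using M_upper[of a x] by linarith
qed

lemma M_le: "M x \<le> 2 * norm x"
proof (rule M_least)
  show "\<bar>g a x\<bar> + \<bar>h a x\<bar> \<le> 2 * norm x" for a
    using g_le[of a x] h_le[of a x] by linarith
qed

lemma M_nonneg: "0 \<le> M x"
  using norm_le_M[of x] norm_ge_zero[of x] by linarith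

lemma M_triangle: "M (x + y) \<le> M x + M y"
proof (rule M_least)
  show "\<bar>g a (x + y)\<bar> + \<bar>h a (x + y)\<bar> \<le> M x + M y" for a
    using M_upper[of a x] M_upper[of a y] by (simp add: g_linear h_linear)
qed

lemma M_scale_le: "M (c *\<^sub>R x) \<le> \<bar>c\<bar> * M x"
proof (rule M_least)
  show "\<bar>g a (c *\<^sub>R x)\<bar> + \<bar>h a (c *\<^sub>R x)\<bar> \<le> \<bar>c\<bar> * M x" for a
    using mult_left_mono[OF M_upper[of a x], of "\<bar>c\<bar>"]
    by (simp add: g_linear h_linear abs_mult distrib_left)
qed

lemma M_scale: "M (c *\<^sub>R x) = \<bar>c\<bar> * M x"
proof (cases "c = 0")
  case True
  then show ?thesis using M_le[of 0] M_nonneg[of 0] by simp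
next
  case False
  have "M ((1 / c) *\<^sub>R (c *\<^sub>R x)) \<le> \<bar>1 / c\<bar> * M (c *\<^sub>R x)"
    by (rule M_scale_le)
  then have "\<bar>c\<bar> * M x \<le> M (c *\<^sub>R x)" using False by (simp add: field_simps)
  then show ?thesis using M_scale_le[of c x] by linarith
qed

lemma Q_term_le: "(1/4) ^ i * (g i x)\<^sup>2 \<le> (1/4) ^ i * (norm x)\<^sup>2"
  using g_le[of i x] by (intro mult_left_mono) (simp_all add: abs_le_square_iff[symmetric])

lemma Q_summable: "summable (\<lambda>i. (1/4) ^ i * (g i x)\<^sup>2)"
proof (rule summable_comparison_test')
  show "summable (\<lambda>i. (1/4::real) ^ i * (norm x)\<^sup>2)"
    by (intro summable_mult2 summable_geometric) simp
  show "norm ((1/4) ^ i * (g i x)\<^sup>2) \<le> (1/4) ^ i * (norm x)\<^sup>2" if "i \<ge> 0" for i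
    using Q_term_le[of i x] by simp
qed

lemma Q_sums: "(\<lambda>i. (1/4) ^ i * (g i x)\<^sup>2) sums Q x"
  unfolding Q_def using Q_summable by (rule summable_sums)

lemma Q_term_le_Q: "(1/4) ^ i * (g i x)\<^sup>2 \<le> Q x"
  unfolding Q_def using sum_le_suminf[OF Q_summable, of "{i}" x] by simp

lemma Q_nonneg: "0 \<le> Q x"
  using Q_term_le_Q[of 0 x] by (smt (verit) mult_nonneg_nonneg zero_le_power2 power_0)

lemma Q_le: "Q x \<le> 2 * (norm x)\<^sup>2"
proof -
  have "(\<lambda>i. (1/4::real) ^ i * (norm x)\<^sup>2) sums ((1 / (1 - 1/4)) * (norm x)\<^sup>2)"
    by (intro sums_mult2 geometric_sums) simp
  then have "Q x \<le> (1 / (1 - 1/4)) * (norm x)\<^sup>2"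
    using sums_le[OF Q_term_le Q_sums] by blast
  then have "Q x \<le> 4/3 * (norm x)\<^sup>2" by simp
  then show ?thesis using zero_le_power2[of "norm x"] by linarith
qed

lemma Q_scale: "Q (c *\<^sub>R x) = c\<^sup>2 * Q x"
proof -
  have "(\<lambda>i. c\<^sup>2 * ((1/4) ^ i * (g i x)\<^sup>2)) sums (c\<^sup>2 * Q x)"
    by (intro sums_mult Q_sums)
  then show ?thesis
    using Q_sums[of "c *\<^sub>R x"] sums_unique2 by (simp add: g_linear power_mult_distrib algebra_simps)
qed

text \<open>\<open>Q\<close> is a quadratic form, so the identity holds term by term. The last term
  is what makes \<open>N\<close> rotund.\<close>

lemma Q_convex_combination:
  assumes "u + v = 1"
  shows "Q (u *\<^sub>R x + v *\<^sub>R y) = u * Q x + v * Q y - u * v * Q (x - y)"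
proof -
  have "(\<lambda>i. u * ((1/4) ^ i * (g i x)\<^sup>2) + v * ((1/4) ^ i * (g i y)\<^sup>2) -
      u * v * ((1/4) ^ i * (g i (x - y))\<^sup>2)) sums (u * Q x + v * Q y - u * v * Q (x - y))"
    by (intro sums_add sums_diff sums_mult Q_sums)
  moreover have "u * ((1/4) ^ i * (g i x)\<^sup>2) + v * ((1/4) ^ i * (g i y)\<^sup>2) -
      u * v * ((1/4) ^ i * (g i (x - y))\<^sup>2) = (1/4) ^ i * (g i (u *\<^sub>R x + v *\<^sub>R y))\<^sup>2" for i
  proof -
    have v: "v = 1 - u" using assms by simp
    have "u * (e * b\<^sup>2) + v * (e * c\<^sup>2) - u * v * (e * (b - c)\<^sup>2) = e * (u * b + v * c)\<^sup>2"
      for e b c :: real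
      unfolding v by (simp add: power2_eq_square algebra_simps)
    then show ?thesis by (simp add: g_linear)
  qed
  ultimately have "(\<lambda>i. (1/4) ^ i * (g i (u *\<^sub>R x + v *\<^sub>R y))\<^sup>2) sums
      (u * Q x + v * Q y - u * v * Q (x - y))" by simp
  then show ?thesis by (rule sums_unique2[OF Q_sums])
qed

lemma N_square: "(N x)\<^sup>2 = (M x)\<^sup>2 + Q x"
  using Q_nonneg[of x] by (simp add: N_def)

lemma N_nonneg: "0 \<le> N x"
  using Q_nonneg[of x] by (simp add: N_def)

lemma norm_le_N: "norm x \<le> N x"
proof -
  have "M x \<le> N x"
    unfolding N_def using Q_nonneg[of x] by (intro real_le_rsqrt) simp
  then show ?thesis using norm_le_M[of x] by linarith
qed

lemma N_le: "N x \<le> 3 * norm x"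
proof -
  have "(M x)\<^sup>2 \<le> (2 * norm x)\<^sup>2"
    using M_le M_nonneg by (intro power_mono)
  then have "(M x)\<^sup>2 \<le> 4 * (norm x)\<^sup>2" by (simp add: power_mult_distrib)
  then have "(M x)\<^sup>2 + Q x \<le> 9 * (norm x)\<^sup>2"
    using Q_le[of x] zero_le_power2[of "norm x"] by linarith
  then have "(M x)\<^sup>2 + Q x \<le> (3 * norm x)\<^sup>2" by (simp add: power_mult_distrib)
  then show ?thesis unfolding N_def by (intro real_le_lsqrt) auto
qed

lemma N_eq_0: "N x = 0 \<longleftrightarrow> x = 0"
  using norm_le_N[of x] N_le[of x] N_nonneg[of x] by auto

lemma N_scale: "N (c *\<^sub>R x) = \<bar>c\<bar> * N x"
  by (simp add: N_def M_scale Q_scale power_mult_distrib real_sqrt_mult flip: distrib_left)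

text \<open>\<open>M\<close> contributes the convexity of its square, \<open>Q\<close> an exact
  identity. The last term is discarded for the triangle inequality and kept for rotundity.\<close>

lemma N_convex_combination:
  assumes "0 \<le> u" "0 \<le> v" "u + v = 1"
  shows "(N (u *\<^sub>R x + v *\<^sub>R y))\<^sup>2 \<le> u * (N x)\<^sup>2 + v * (N y)\<^sup>2 - u * v * Q (x - y)"
proof -
  have "M (u *\<^sub>R x + v *\<^sub>R y) \<le> u * M x + v * M y"
    using M_triangle[of "u *\<^sub>R x" "v *\<^sub>R y"] assms by (simp add: M_scale)
  then have "(M (u *\<^sub>R x + v *\<^sub>R y))\<^sup>2 \<le> (u * M x + v * M y)\<^sup>2"
    using M_nonneg by (intro power_mono)
  moreover have "u * b\<^sup>2 + v * c\<^sup>2 - (u * b + v * c)\<^sup>2 = u * v * (b - c)\<^sup>2" for b c :: real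
  proof -
    have v: "v = 1 - u" using assms by simp
    show ?thesis unfolding v by (simp add: power2_eq_square algebra_simps)
  qed
  then have "(u * M x + v * M y)\<^sup>2 \<le> u * (M x)\<^sup>2 + v * (M y)\<^sup>2"
    using assms by (metis diff_ge_0_iff_ge mult_nonneg_nonneg zero_le_power2)
  ultimately show ?thesis
    using Q_convex_combination[OF assms(3), of x y] by (simp add: N_square distrib_left)
qed

text \<open>Convexity of the square of \<open>N\<close>, applied to the normalized vectors with
  weights \<open>N x / s\<close> and \<open>N y / s\<close>, puts
  \<open>(1 / s) *\<^sub>R (x + y)\<close> into the unit ball.\<close>

lemma N_triangle: "N (x + y) \<le> N x + N y"
proof (cases "x = 0 \<or> y = 0")
  case True
  then show ?thesis using N_nonneg by auto
next
  case False
  then have pos: "N x > 0" "N y > 0"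
    using N_eq_0 N_nonneg by (simp_all add: order_less_le)
  define s where "s = N x + N y"
  have s: "s > 0" using pos by (simp add: s_def)
  define z where "z = (N x / s) *\<^sub>R ((1 / N x) *\<^sub>R x) + (N y / s) *\<^sub>R ((1 / N y) *\<^sub>R y)"
  have z: "z = (1 / s) *\<^sub>R (x + y)"
    using pos by (simp add: z_def scaleR_add_right)
  have "N x / s + N y / s = 1"
    using s by (simp add: s_def flip: add_divide_distrib)
  moreover have "N ((1 / N x) *\<^sub>R x) = 1" "N ((1 / N y) *\<^sub>R y) = 1"
    using pos by (simp_all add: N_scale)
  moreover have "0 \<le> N x / s * (N y / s) * Q ((1 / N x) *\<^sub>R x - (1 / N y) *\<^sub>R y)"
    using pos s Q_nonneg by simp
  ultimately have "(N z)\<^sup>2 \<le> 1"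
    using N_convex_combination[of "N x / s" "N y / s" "(1 / N x) *\<^sub>R x" "(1 / N y) *\<^sub>R y"] pos s
    unfolding z_def by simp
  then have "N z \<le> 1" using N_nonneg power2_le_imp_le[of "N z" 1] by simp
  moreover have "N z = N (x + y) / s" unfolding z N_scale using s by simp
  ultimately show ?thesis using s by (simp add: s_def)
qed

lemma equivalent_norm_N: "equivalent_norm N"
  unfolding equivalent_norm_def
proof (intro conjI allI)
  show "\<exists>c>0. \<exists>C>0. \<forall>x. c * norm x \<le> N x \<and> N x \<le> C * norm x"
    using norm_le_N N_le by (intro exI[of _ 1] conjI exI[of _ 3]) auto
qed (rule N_eq_0 N_triangle N_scale)+

lemma Q_eq_0D:
  assumes "Q x = 0"
  shows "x = 0"
proof -
  have "g i x = 0" for i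
  proof -
    have "(1/4::real) ^ i > 0" by simp
    then show ?thesis using Q_term_le_Q[of i x] assms by (simp add: mult_le_0_iff del: zero_less_power)
  qed
  then have "norm x \<le> 0" by (intro norm_le_of_g) simp
  then show ?thesis by simp
qed

lemma rotund_N: "rotund N"
  unfolding rotund_def
proof (intro ballI impI)
  fix x y z
  assume "x \<in> unit_sphere_of N" "y \<in> unit_ball_of N" "z \<in> unit_ball_of N" and eq: "2 *\<^sub>R x = y + z"
  then have n: "N x = 1" "N y \<le> 1" "N z \<le> 1"
    by (auto simp: unit_sphere_of_def unit_ball_of_def)
  have "(1/2) *\<^sub>R (2 *\<^sub>R x) = (1/2) *\<^sub>R (y + z)" using eq by (simp only:)
  then have x: "x = (1/2) *\<^sub>R y + (1/2) *\<^sub>R z" by (simp add: scaleR_add_right)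
  have "(N y)\<^sup>2 \<le> 1" "(N z)\<^sup>2 \<le> 1" using n N_nonneg by (simp_all add: power_le_one)
  then have "Q (y - z) \<le> 0"
    using N_convex_combination[of "1/2" "1/2" y z] n(1) unfolding x[symmetric] by simp
  then have "y = z" using Q_nonneg[of "y - z"] Q_eq_0D[of "y - z"] by simp
  then show "x = y \<and> y = z" using x by (simp flip: scaleR_add_left)
qed

section \<open>Points with \<open>norm x < M x\<close> are not MLUR points\<close>

lemma M_flat:
  assumes "norm x < M x"
  obtains \<rho> where "\<rho> > 0"
    "\<And>n. \<exists>y. norm y = \<rho> \<and> (\<forall>i<n. g i y = 0) \<and> M (x + y) = M x \<and> M (x - y) = M x"
proof -
  \<comment> \<open>A third of the gap: for indices from \<open>A\<close> on,
    \<open>\<bar>h a x\<bar>\<close>, \<open>\<bar>g a y\<bar>\<close> and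
    \<open>\<bar>h a y\<bar>\<close> each cost at most \<open>\<rho>\<close>. The finitely many
    earlier terms do not change if \<open>y\<close> is killed by their functionals.\<close>
  define \<rho> where "\<rho> = (M x - norm x) / 3"
  have \<rho>: "\<rho> > 0" using assms by (simp add: \<rho>_def)
  obtain A where A: "\<And>a. a \<ge> A \<Longrightarrow> \<bar>h a x\<bar> < \<rho>"
    using LIMSEQ_D[OF h_tendsto \<rho>, of x] by auto
  have le: "M (x + y) \<le> M x" if "norm y = \<rho>" "\<And>a. a < A \<Longrightarrow> g a y = 0 \<and> h a y = 0" for y
  proof (rule M_least)
    fix a
    show "\<bar>g a (x + y)\<bar> + \<bar>h a (x + y)\<bar> \<le> M x"
    proof (cases "a < A")
      case True
      then show ?thesis using that(2)[OF True] M_upper[of a x] by (simp add: g_linear h_linear)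
    next
      case False
      then have "\<bar>g a (x + y)\<bar> + \<bar>h a (x + y)\<bar> \<le> (norm x + \<rho>) + (\<rho> + \<rho>)"
        using A[of a] g_le[of a x] g_le[of a y] h_le[of a y] that(1)
        unfolding g_linear h_linear by linarith
      then show ?thesis by (simp add: \<rho>_def field_simps)
    qed
  qed
  have "\<exists>y. norm y = \<rho> \<and> (\<forall>i<n. g i y = 0) \<and> M (x + y) = M x \<and> M (x - y) = M x" for n
  proof -
    \<comment> \<open>The first \<open>A\<close> functionals of both kinds protect the supremum; the
      further \<open>g i\<close> protect the first \<open>n\<close> terms of
      \<open>Q\<close>.\<close>
    define F where "F = g ` {..<A + n} \<union> h ` {..<A}"
    have "finite F" "\<And>f. f \<in> F \<Longrightarrow> linear f"
      using linear_g linear_h by (auto simp: F_def)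
    then obtain w where w: "w \<noteq> 0" "\<And>f. f \<in> F \<Longrightarrow> f w = 0"
      using ex_common_kernel[OF _ _ infinite_dim] by blast
    define y where "y = (\<rho> / norm w) *\<^sub>R w"
    have y: "norm y = \<rho>" using w \<rho> by (simp add: y_def)
    have gy: "g a y = 0" if "a < A + n" for a
      using w(2)[of "g a"] that by (simp add: y_def g_linear F_def)
    have hy: "h a y = 0" if "a < A" for a
      using w(2)[of "h a"] that by (simp add: y_def h_linear F_def)
    have "M (x + y) \<le> M x" using y gy hy by (intro le) auto
    moreover have "M (x + - y) \<le> M x"
      using y gy hy by (intro le) (auto simp: linear_neg[OF linear_g] linear_neg[OF linear_h])
    \<comment> \<open>As \<open>x\<close> is the midpoint of \<open>x + y\<close> and
      \<open>x - y\<close>, the two upper bounds must be equalities.\<close>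
    moreover have "2 * M x \<le> M (x + y) + M (x - y)"
      using M_triangle[of "x + y" "x - y"] M_scale[of 2 x] by (simp add: scaleR_2)
    ultimately have "M (x + y) = M x" "M (x - y) = M x" by simp_all
    then show ?thesis using y gy by (intro exI[of _ y]) auto
  qed
  with \<rho> show thesis using that by blast
qed

text \<open>The terms below \<open>n\<close> agree. In the others \<open>(1/4) ^ i\<close> splits
  into two factors \<open>(1/2) ^ i\<close>: one is bounded by \<open>(1/2) ^ n\<close>, the other
  is summed.\<close>

lemma Q_perturb:
  assumes "\<And>i. i < n \<Longrightarrow> g i y = 0"
  shows "\<bar>Q (x + y) - Q x\<bar> \<le> (2 * norm y * (2 * norm x + norm y)) * (1/2) ^ n"
proof -
  define K where "K = norm y * (2 * norm x + norm y)"
  define d where "d = (\<lambda>i. (1/4) ^ i * (g i (x + y))\<^sup>2 - (1/4) ^ i * (g i x)\<^sup>2)"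
  have d: "d sums (Q (x + y) - Q x)"
    unfolding d_def by (intro sums_diff Q_sums)
  have bound: "(\<lambda>i. K * (1/2) ^ n * (1/2::real) ^ i) sums (K * (1/2) ^ n * (1 / (1 - 1/2)))"
    by (intro sums_mult geometric_sums) simp
  have "norm (d i) \<le> K * (1/2) ^ n * (1/2) ^ i" for i
  proof (cases "i < n")
    case True
    then have "d i = 0" using assms by (simp add: d_def g_linear)
    then show ?thesis by (simp add: K_def)
  next
    case False
    have "d i = (1/4) ^ i * (g i y * (2 * g i x + g i y))"
      by (simp add: d_def g_linear power2_eq_square algebra_simps)
    then have "norm (d i) = (1/4) ^ i * (\<bar>g i y\<bar> * \<bar>2 * g i x + g i y\<bar>)"
      by (simp add: abs_mult)
    also have "\<dots> \<le> (1/4) ^ i * K"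
      unfolding K_def using g_le[of i x] g_le[of i y] by (intro mult_left_mono mult_mono) auto
    also have "(1/4::real) ^ i = (1/2) ^ i * (1/2) ^ i"
      by (simp flip: power_mult_distrib)
    also have "(1/2::real) ^ i * (1/2) ^ i * K \<le> (1/2) ^ n * (1/2) ^ i * K"
      using False by (intro mult_right_mono power_decreasing) (auto simp: K_def)
    finally show ?thesis by (simp add: algebra_simps)
  qed
  then have "norm (suminf d) \<le> (\<Sum>i. K * (1/2) ^ n * (1/2) ^ i)"
    using bound by (intro norm_suminf_le) (auto simp: sums_iff)
  moreover have "suminf d = Q (x + y) - Q x" using d by (simp add: sums_iff)
  moreover have "(\<Sum>i. K * (1/2) ^ n * (1/2) ^ i) = 2 * K * (1/2) ^ n" using bound by (simp add: sums_iff)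
  ultimately show ?thesis by (simp add: K_def mult.assoc)
qed

lemma not_MLUR:
  assumes "norm x < M x"
  shows "x \<notin> MLUR_points N"
proof
  assume x: "x \<in> MLUR_points N"
  obtain \<rho> where \<rho>: "\<rho> > 0" and
    "\<And>n. \<exists>y. norm y = \<rho> \<and> (\<forall>i<n. g i y = 0) \<and> M (x + y) = M x \<and> M (x - y) = M x"
    using M_flat[OF assms] by blast
  then obtain Y where Y: "\<And>n. norm (Y n) = \<rho>" "\<And>n i. i < n \<Longrightarrow> g i (Y n) = 0"
    "\<And>n. M (x + Y n) = M x" "\<And>n. M (x - Y n) = M x"
    by metis
  \<comment> \<open>Stated for a general sequence, since it is applied to \<open>Y\<close> and to
    its negative.\<close>
  have lim: "(\<lambda>n. N (x + Z n)) \<longlonglongrightarrow> N x"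
    if Z: "\<And>n. norm (Z n) = \<rho>" "\<And>n i. i < n \<Longrightarrow> g i (Z n) = 0" "\<And>n. M (x + Z n) = M x" for Z
  proof -
    have "(\<lambda>n. 2 * \<rho> * (2 * norm x + \<rho>) * (1/2) ^ n) \<longlonglongrightarrow> 2 * \<rho> * (2 * norm x + \<rho>) * 0"
      by (intro tendsto_mult_left LIMSEQ_power_zero) simp
    moreover have "\<forall>\<^sub>F n in sequentially. norm (Q (x + Z n) - Q x) \<le> 2 * \<rho> * (2 * norm x + \<rho>) * (1/2) ^ n"
      using Q_perturb[OF Z(2)] by (simp add: Z(1))
    ultimately have "(\<lambda>n. Q (x + Z n) - Q x) \<longlonglongrightarrow> 0"
      by (intro Lim_null_comparison[of "\<lambda>n. Q (x + Z n) - Q x"]) auto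
    then have "(\<lambda>n. Q (x + Z n)) \<longlonglongrightarrow> Q x"
      by (rule LIM_zero_cancel)
    then show ?thesis
      unfolding N_def Z(3) by (intro tendsto_intros)
  qed
  have 1: "(\<lambda>n. N (x + Y n)) \<longlonglongrightarrow> N x"
    using Y by (intro lim)
  have 2: "(\<lambda>n. N (x + - Y n)) \<longlonglongrightarrow> N x"
    using Y by (intro lim) (auto simp: linear_neg[OF linear_g])
  have "(1/2) *\<^sub>R ((x + Y n) + (x + - Y n)) - x = 0" for n
    by (simp add: scaleR_2[symmetric])
  then have 3: "(\<lambda>n. N ((1/2) *\<^sub>R ((x + Y n) + (x + - Y n)) - x)) \<longlonglongrightarrow> 0"
    using N_eq_0[of 0] by simp
  note midpoint = CollectD[OF x[unfolded MLUR_points_def], THEN conjunct2, rule_format,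
      of "\<lambda>n. x + Y n" "\<lambda>n. x + - Y n"]
  have "(\<lambda>n. N ((x + Y n) - (x + - Y n))) \<longlonglongrightarrow> 0"
    by (rule midpoint) (intro conjI 1 2 3)
  moreover have "N ((x + Y n) - (x + - Y n)) = 2 * N (Y n)" for n
    using N_scale[of 2 "Y n"] by (simp add: scaleR_2)
  ultimately have "(\<lambda>n. 2 * N (Y n)) \<longlonglongrightarrow> 0" by simp
  moreover have "2 * \<rho> \<le> 2 * N (Y n)" for n
    using norm_le_N[of "Y n"] Y(1)[of n] by simp
  ultimately have "2 * \<rho> \<le> 0"
    by (intro LIMSEQ_le_const[of "\<lambda>n. 2 * N (Y n)"]) auto
  with \<rho> show False by simp
qed

section \<open>Porosity of the set of MLUR points\<close>

lemma N_diff_le: "N x - N y \<le> N (x - y)"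
  using N_triangle[of "x - y" y] by simp

lemma N_minus_commute: "N (x - y) = N (y - x)"
  using N_scale[of "-1" "x - y"] by simp

lemma porous_MLUR_points:
  "Metric_space.porous (unit_sphere_of N) (\<lambda>x y. N (x - y)) (MLUR_points N)"
proof -
  interpret S: Metric_space "unit_sphere_of N" "\<lambda>x y. N (x - y)"
    by (rule equivalent_norm_Metric_space) (rule equivalent_norm_N)
  \<comment> \<open>The center \<open>y\<close> will satisfy
    \<open>M y - norm y \<ge> \<delta> / 72\<close>. The function \<open>M - norm\<close> is
    3-Lipschitz, so within \<open>\<delta> / 300\<close> it loses at most
    \<open>\<delta> / 100\<close> and stays positive.\<close>
  have "\<exists>y\<in>unit_sphere_of N. N (x - y) < \<delta> \<and> MLUR_points N \<inter> S.mball y (1/300 * \<delta>) = {}"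
    if x: "x \<in> MLUR_points N" and \<delta>: "0 < \<delta>" "\<delta> < 1" for x \<delta>
  proof -
    have Nx: "N x = 1" using x by (simp add: MLUR_points_def unit_sphere_of_def)
    \<comment> \<open>By \<open>N_le\<close>, radius \<open>\<delta> / 6\<close> in the original
      norm means \<open>\<delta> / 2\<close> in \<open>N\<close>. The other half of
      \<open>\<delta>\<close> pays for moving \<open>p a\<close> radially onto the sphere, a
      displacement of \<open>\<bar>N w - 1\<bar>\<close>.\<close>
    obtain a where a: "norm (p a - x) < \<delta> / 6" "\<delta> / 36 \<le> h a (p a)"
      using approx[of "\<delta> / 6" x] \<delta> by auto
    define w where "w = p a"
    have wx: "N (w - x) < \<delta> / 2" using N_le[of "w - x"] a(1) by (simp add: w_def)
    have Nw: "1 / 2 < N w" "N w < 2" "\<bar>N w - 1\<bar> < \<delta> / 2"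
      using N_diff_le[of w x] N_diff_le[of x w] N_minus_commute[of x w] wx Nx \<delta> by linarith+
    define y where "y = (1 / N w) *\<^sub>R w"
    have Ny: "N y = 1" using Nw by (simp add: y_def N_scale)
    have "w - y = (1 - 1 / N w) *\<^sub>R w" by (simp add: y_def scaleR_diff_left)
    then have "N (w - y) = \<bar>1 - 1 / N w\<bar> * \<bar>N w\<bar>" using Nw by (simp add: N_scale)
    also have "\<dots> = \<bar>(1 - 1 / N w) * N w\<bar>" by (rule abs_mult[symmetric])
    also have "(1 - 1 / N w) * N w = N w - 1" using Nw by (simp add: left_diff_distrib)
    finally have "N (x - y) < \<delta>"
      using N_triangle[of "x - w" "w - y"] wx Nw(3) N_minus_commute[of x w] by simp
    moreover have "norm w + \<delta> / 36 \<le> M w"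
      using M_upper[of a w] a(2) by (simp add: w_def g_norming)
    then have "(norm w + \<delta> / 36) / N w \<le> M w / N w" using Nw by (intro divide_right_mono) auto
    then have "norm y + \<delta> / 36 / N w \<le> M y"
      using Nw by (simp add: y_def M_scale add_divide_distrib)
    \<comment> \<open>Normalization divides the gap by \<open>N w < 2\<close>, which at most halves
      it.\<close>
    moreover have "\<delta> / 36 / 2 \<le> \<delta> / 36 / N w" using Nw \<delta> by (intro divide_left_mono) auto
    ultimately have My: "norm y + \<delta> / 72 \<le> M y" and xy: "N (x - y) < \<delta>" by simp_all
    have "t \<notin> MLUR_points N" if "N (y - t) < 1/300 * \<delta>" for t
    proof (rule not_MLUR)
      have "norm (y - t) < 1/300 * \<delta>" using that norm_le_N[of "y - t"] by simp
      moreover have "norm t \<le> norm y + norm (y - t)"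
        by (metis norm_minus_commute norm_triangle_sub)
      moreover have "M y \<le> M t + M (y - t)" using M_triangle[of t "y - t"] by simp
      ultimately show "norm t < M t" using M_le[of "y - t"] My \<delta> by simp
    qed
    then have "MLUR_points N \<inter> S.mball y (1/300 * \<delta>) = {}"
      by (auto simp: S.mball_def)
    then show ?thesis using xy Ny by (intro bexI[of _ y]) (auto simp: unit_sphere_of_def)
  qed
  moreover have "MLUR_points N \<subseteq> unit_sphere_of N" by (auto simp: MLUR_points_def)
  ultimately show ?thesis
    unfolding S.porous_def by (intro conjI exI[of _ "1/300"] exI[of _ 1]) auto
qed

end

theorem theorem3p9:
  assumes separable: "separable_space (euclidean :: 'a::banach topology)"
    and infinite_dim: "\<not> (\<exists>B :: 'a set. finite B \<and> span B = UNIV)"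
  shows "\<exists>N :: 'a \<Rightarrow> real. equivalent_norm N \<and> rotund N \<and>
           Metric_space.porous (unit_sphere_of N) (\<lambda>x y. N (x - y)) (MLUR_points N)"
proof -
  obtain p :: "nat \<Rightarrow> 'a" and h :: "nat \<Rightarrow> 'a \<Rightarrow> real" where
    h: "\<And>a. linear (h a)" "\<And>a x. \<bar>h a x\<bar> \<le> norm x" "\<And>x. (\<lambda>a. h a x) \<longlonglongrightarrow> 0"
    "\<And>x \<delta>. 0 < \<delta> \<Longrightarrow> \<delta> < 1 \<Longrightarrow> \<exists>a. norm (p a - x) < \<delta> \<and> \<delta> / 6 \<le> h a (p a)"
    by (rule ex_functional_system[OF separable infinite_dim]) blast
  \<comment> \<open>The norming functionals come last, because they depend on the points
    \<open>p a\<close>.\<close>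
  have "\<forall>a. \<exists>g :: 'a \<Rightarrow> real. linear g \<and> (\<forall>x. \<bar>g x\<bar> \<le> norm x) \<and> g (p a) = norm (p a)"
    using ex_norming_functional by blast
  then have "\<exists>g :: nat \<Rightarrow> 'a \<Rightarrow> real. \<forall>a. linear (g a) \<and> (\<forall>x. \<bar>g a x\<bar> \<le> norm x) \<and> g a (p a) = norm (p a)"
    by (simp only: choice_iff)
  then obtain g :: "nat \<Rightarrow> 'a \<Rightarrow> real" where
    g: "\<forall>a. linear (g a) \<and> (\<forall>x. \<bar>g a x\<bar> \<le> norm x) \<and> g a (p a) = norm (p a)" by blast
  interpret functional_system p g h
    by (rule functional_system.intro) (use g in blast, use g in blast, use g in blast, fact+)
  show ?thesis
    using equivalent_norm_N rotund_N porous_MLUR_points by blast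
qed

end
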